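(* Let $\epsilon>0$, $p\ge1$, $\delta\le\frac\epsilon2$, and let $\mathcal X\subseteq\mathbb R^n$ be any closed convex set. Let $F:\mathcal X\to\mathbb R^n$ be a monotone, continuous operator that is $p$th-order $L_p$-smooth with respect to an arbitrary norm $\|\cdot\|$. Let $\omega(\cdot,\cdot)$ denote the Bregman divergence of a function $d$ that is strongly convex with respect to the same norm $\|\cdot\|$. Then the procedure MVI-OPT-APPROX (defined in the context), started at $\mathbf x_0\in\mathcal X$, returns $\hat{\mathbf x}$ such that for all $\mathbf x\in\mathcal X$, $$\langle F(\mathbf x),\hat{\mathbf x}-\mathbf x\rangle\le\epsilon,$$ in at most $$\frac{16}{15}\left(\frac{4L_p}{p!}\right)^{\frac2{p+1}}\frac{\omega(\mathbf x,\mathbf x_0)}{\epsilon^{2/(p+1)}}$$ calls to the $\delta$-approximate subproblem solver Approx-VI-Solve described in the context.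
   Context: $\|\cdot\|_*$ is the dual norm of $\|\cdot\|$. An operator $F:\mathcal X\to\mathbb R^n$ is monotone if $\langle F(\mathbf x)-F(\mathbf y),\mathbf x-\mathbf y\rangle\ge 0$ for all $\mathbf x,\mathbf y\in\mathcal X$. Taylor expansion: $\mathcal T_k(\mathbf y;\mathbf x)=\sum_{i=0}^{k}\frac1{i!}\nabla^iF(\mathbf x)[\mathbf y-\mathbf x]^i$, where $\nabla^iF(\mathbf x)[\mathbf h]^i$ is the $i$th directional derivative of $F$ at $\mathbf x$ along $\mathbf h$ (a vector in $\mathbb R^n$), and $\nabla^iF(\mathbf x)[\mathbf h]^{i+1}$ is the scalar obtained by contracting it once more with $\mathbf h$. For $p\ge1$, $F$ is $p$th-order $L_p$-smooth with respect to $\|\cdot\|$ if for all $\mathbf x,\mathbf y\in\mathcal X$, $\|\nabla^{p-1}F(\mathbf y)-\nabla^{p-1}F(\mathbf x)\|_*\le L_p\|\mathbf y-\mathbf x\|$, or $\|F(\mathbf y)-\mathcal T_{p-1}(\mathbf y;\mathbf x)\|_*\le\frac{L_p}{p!}\|\mathbf y-\mathbf x\|^p$; here $\|\nabla^{p-1}F(\mathbf y)-\nabla^{p-1}F(\mathbf x)\|_*=\max_{\|\mathbf h\|\le1}|\nabla^{p-1}F(\mathbf y)[\mathbf h]^p-\nabla^{p-1}F(\mathbf x)[\mathbf h]^p|$. $d:\mathcal X\to\mathbb R$ is strongly convex with respect to $\|\cdot\|$ in the normalization $d(\mathbf x)-d(\mathbf y)-\langle\nabla d(\mathbf y),\mathbf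 x-\mathbf y\rangle\ge\|\mathbf x-\mathbf y\|^2$; its Bregman divergence is $\omega(\mathbf x,\mathbf y)=d(\mathbf x)-d(\mathbf y)-\langle\nabla d(\mathbf y),\mathbf x-\mathbf y\rangle$. Approximate subproblem solver: for any $\bar{\mathbf x}\in\mathcal X$, Approx-VI-Solve$_{p,\delta}(\bar{\mathbf x})$ outputs a $\delta$-approximate solution of the regularized $p$th-order variational inequality at $\bar{\mathbf x}$, i.e. a point $\tilde T\in\mathcal X$ with $\langle U_{p,\bar{\mathbf x}}(\tilde T),\tilde T-\mathbf x\rangle\le\delta$ for all $\mathbf x\in\mathcal X$, where $$U_{p,\mathbf x}(\mathbf y)=\mathcal T_{p-1}(\mathbf y;\mathbf x)+\frac{2L_p}{p!}\,\omega(\mathbf y,\mathbf x)^{\frac{p-1}{2}}\big(\nabla d(\mathbf y)-\nabla d(\mathbf x)\big).$$ Procedure MVI-OPT-APPROX$(\mathbf x_0\in\mathcal X,K,p,\delta)$: for $i=0,1,\dots,K$ set $\mathbf x_{i+\frac12}=$ Approx-VI-Solve$_{p,\delta}(\mathbf x_i)$; $\lambda_i=\frac12\,\omega(\mathbf x_{i+\frac12},\mathbf x_i)^{-\frac{p-1}{2}}$; $\mathbf x_{i+1}=\arg\min_{\mathbf x\in\mathcal X}\{\langle F(\mathbf x_{i+\frac12}),\mathbf x-\mathbf x_{i+\frac12}\rangle+\frac{L_p}{p!\lambda_i}\omega(\mathbf x,\mathbf x_i)\}$. Return $\hat{\mathbf x}_K=\big(\sum_{i=0}^K\lambda_i\mathbf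 x_{i+\frac12}\big)/\sum_{i=0}^K\lambda_i$, which is the point $\hat{\mathbf x}$ of the claim.
   Formalization: In the first smoothness condition the difference of (p−1)th derivatives is contracted with h in p−1 slots and an independent vector v in the last (max over ‖h‖,‖v‖≤1), not the same h in all p slots, for which the claim fails; also L_p>0 is assumed. *)

theory Defs
  imports "HOL-Analysis.Analysis"
begin

(* The arbitrary norm is a function N; the type's own Euclidean norm is only used
   through the inner product and the topology. *)
definition is_norm :: "('a::real_vector \<Rightarrow> real) \<Rightarrow> bool" where
  "is_norm N \<longleftrightarrow>
     (\<forall>x. N x = 0 \<longleftrightarrow> x = 0) \<and>
     (\<forall>c x. N (c *\<^sub>R x) = \<bar>c\<bar> * N x) \<and>
     (\<forall>x y. N (x + y) \<le> N x + N y)"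

definition dual_norm :: "('a::euclidean_space \<Rightarrow> real) \<Rightarrow> 'a \<Rightarrow> real" where
  "dual_norm N v = (SUP h\<in>{h. N h \<le> 1}. v \<bullet> h)"

definition monotone_operator_on :: "'a::euclidean_space set \<Rightarrow> ('a \<Rightarrow> 'a) \<Rightarrow> bool" where
  "monotone_operator_on X F \<longleftrightarrow> (\<forall>x\<in>X. \<forall>y\<in>X. (F x - F y) \<bullet> (x - y) \<ge> 0)"

definition line_params :: "'a::real_vector set \<Rightarrow> 'a \<Rightarrow> 'a \<Rightarrow> real set" where
  "line_params X x h = {t. x + t *\<^sub>R h \<in> X}"

(* The i-th directional derivative of F at x along h. Operators are only given on X, so the
   parameter t is confined to the part of the line lying in X: derivatives are one-sided at
   boundary points, and no values of F outside X are involved. *)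
primrec dir_deriv ::
  "'a::real_normed_vector set \<Rightarrow> ('a \<Rightarrow> 'a) \<Rightarrow> nat \<Rightarrow> 'a \<Rightarrow> 'a \<Rightarrow> 'a" where
  "dir_deriv X F 0 x h = F x"
| "dir_deriv X F (Suc i) x h =
     vector_derivative (\<lambda>t. dir_deriv X F i (x + t *\<^sub>R h) h) (at 0 within line_params X x h)"

definition taylor_op ::
  "'a::real_normed_vector set \<Rightarrow> ('a \<Rightarrow> 'a) \<Rightarrow> nat \<Rightarrow> 'a \<Rightarrow> 'a \<Rightarrow> 'a" where
  "taylor_op X F k y x = (\<Sum>i\<le>k. (1 / fact i) *\<^sub>R dir_deriv X F i x (y - x))"

(* Existence of the derivatives up to order p - 1. Where the line meets X only in x the filter
   is trivial and nothing is required. *)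
definition dir_differentiable_upto ::
  "'a::real_normed_vector set \<Rightarrow> ('a \<Rightarrow> 'a) \<Rightarrow> nat \<Rightarrow> bool" where
  "dir_differentiable_upto X F m \<longleftrightarrow>
     (\<forall>i<m. \<forall>x\<in>X. \<forall>h. (\<lambda>t. dir_deriv X F i (x + t *\<^sub>R h) h)
        differentiable (at 0 within line_params X x h))"

(* Either of the two conditions may hold (throughout X). In the first one the derivative along h,
   a vector, is measured in the dual norm, so that the last slot of the derivative tensor is
   tested against a vector independent of h. Contracting all p slots with the same h would be
   too weak: the tensor is not symmetric in its last slot, and such a condition does not give
   the second one. Directions h along which X does not extend from x or from y carry no
   derivative and are left out. *)
definition smooth_operator_on ::
  "('a::euclidean_space \<Rightarrow> real) \<Rightarrow> 'a set \<Rightarrow> nat \<Rightarrow> real \<Rightarrow> ('a \<Rightarrow> 'a) \<Rightarrow> bool" where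
  "smooth_operator_on N X p L F \<longleftrightarrow>
     dir_differentiable_upto X F (p - 1) \<and>
     ((\<forall>x\<in>X. \<forall>y\<in>X. \<forall>h. N h \<le> 1 \<longrightarrow> line_params X x h \<noteq> {0} \<longrightarrow> line_params X y h \<noteq> {0} \<longrightarrow>
         dual_norm N (dir_deriv X F (p - 1) y h - dir_deriv X F (p - 1) x h) \<le> L * N (y - x))
      \<or>
      (\<forall>x\<in>X. \<forall>y\<in>X.
         dual_norm N (F y - taylor_op X F (p - 1) y x) \<le> L / fact p * N (y - x) ^ p))"

definition bregman :: "('a::euclidean_space \<Rightarrow> real) \<Rightarrow> ('a \<Rightarrow> 'a) \<Rightarrow> 'a \<Rightarrow> 'a \<Rightarrow> real" where
  "bregman d gd x y = d x - d y - gd y \<bullet> (x - y)"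

(* gd is the gradient of d. It is a gradient relative to X, hence unique only if X has nonempty
   interior; all inner products below are with differences of points of X. *)
definition strongly_convex_with_gradient ::
  "('a::euclidean_space \<Rightarrow> real) \<Rightarrow> 'a set \<Rightarrow> ('a \<Rightarrow> real) \<Rightarrow> ('a \<Rightarrow> 'a) \<Rightarrow> bool" where
  "strongly_convex_with_gradient N X d gd \<longleftrightarrow>
     (\<forall>y\<in>X. (d has_derivative (\<lambda>h. gd y \<bullet> h)) (at y within X)) \<and>
     (\<forall>x\<in>X. \<forall>y\<in>X. d x - d y - gd y \<bullet> (x - y) \<ge> (N (x - y))\<^sup>2)"

(* The power (p - 1) / 2 of the divergence is written as a natural power of its square root,
   because 0 powr 0 = 0 would give the wrong value for p = 1. *)
definition regularized_operator ::
  "'a::euclidean_space set \<Rightarrow> ('a \<Rightarrow> 'a) \<Rightarrow> ('a \<Rightarrow> real) \<Rightarrow> ('a \<Rightarrow> 'a) \<Rightarrow> nat \<Rightarrow> real \<Rightarrow> 'a \<Rightarrow> 'a \<Rightarrow> 'a"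
where
  "regularized_operator X F d gd p L x y =
     taylor_op X F (p - 1) y x
     + (2 * L / fact p * sqrt (bregman d gd y x) ^ (p - 1)) *\<^sub>R (gd y - gd x)"

definition approx_vi_solution ::
  "'a::euclidean_space set \<Rightarrow> ('a \<Rightarrow> 'a) \<Rightarrow> ('a \<Rightarrow> real) \<Rightarrow> ('a \<Rightarrow> 'a) \<Rightarrow> nat \<Rightarrow> real \<Rightarrow> real \<Rightarrow> 'a \<Rightarrow> 'a \<Rightarrow> bool"
where
  "approx_vi_solution X F d gd p L \<delta> xbar T \<longleftrightarrow>
     T \<in> X \<and> (\<forall>x\<in>X. regularized_operator X F d gd p L xbar T \<bullet> (T - x) \<le> \<delta>)"

definition step_weight ::
  "('a::euclidean_space \<Rightarrow> real) \<Rightarrow> ('a \<Rightarrow> 'a) \<Rightarrow> nat \<Rightarrow> 'a \<Rightarrow> 'a \<Rightarrow> real" where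
  "step_weight d gd p y x = 1 / (2 * sqrt (bregman d gd y x) ^ (p - 1))"

primrec mvi_iterate ::
  "'a::euclidean_space set \<Rightarrow> ('a \<Rightarrow> 'a) \<Rightarrow> ('a \<Rightarrow> real) \<Rightarrow> ('a \<Rightarrow> 'a) \<Rightarrow> nat \<Rightarrow> real \<Rightarrow> ('a \<Rightarrow> 'a)
     \<Rightarrow> 'a \<Rightarrow> nat \<Rightarrow> 'a" where
  "mvi_iterate X F d gd p L solve x0 0 = x0"
| "mvi_iterate X F d gd p L solve x0 (Suc i) =
     (let x = mvi_iterate X F d gd p L solve x0 i; y = solve x
      in arg_min_on (\<lambda>z. F y \<bullet> (z - y)
           + L / (fact p * step_weight d gd p y x) * bregman d gd z x) X)"

(* The output after the K + 1 solver calls i = 0, ..., K. If p > 1 and the divergence vanishes in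
   some step, the weight of that step is infinite; the average is then understood as the
   half-step point of the first such step. *)
definition mvi_opt_approx ::
  "'a::euclidean_space set \<Rightarrow> ('a \<Rightarrow> 'a) \<Rightarrow> ('a \<Rightarrow> real) \<Rightarrow> ('a \<Rightarrow> 'a) \<Rightarrow> nat \<Rightarrow> real \<Rightarrow> ('a \<Rightarrow> 'a)
     \<Rightarrow> 'a \<Rightarrow> nat \<Rightarrow> 'a" where
  "mvi_opt_approx X F d gd p L solve x0 K =
     (let x = mvi_iterate X F d gd p L solve x0;
          y = (\<lambda>i. solve (x i));
          w = (\<lambda>i. step_weight d gd p (y i) (x i))
      in if p > 1 \<and> (\<exists>i\<le>K. bregman d gd (y i) (x i) = 0)
         then y (LEAST i. bregman d gd (y i) (x i) = 0)
         else (1 / (\<Sum>i\<le>K. w i)) *\<^sub>R (\<Sum>i\<le>K. w i *\<^sub>R y i))"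

end

theory Submission
  imports Defs
begin

text \<open>One iteration satisfies
  \<open>\<lambda>\<^sub>i \<langle>F y\<^sub>i, y\<^sub>i - u\<rangle> \<le> \<lambda>\<^sub>i \<delta> + L / p! (\<omega>(u, x\<^sub>i) - \<omega>(u, x\<^sub>i\<^sub>+\<^sub>1) - 15/16 \<omega>(y\<^sub>i, x\<^sub>i))\<close>:
  add the optimality condition of the proximal step and the approximate variational inequality,
  and absorb the Taylor error into the divergences. After telescoping, either the negative terms
  outweigh \<open>\<omega>(u, x\<^sub>0)\<close>, or \<open>\<Sum> \<omega>(y\<^sub>i, x\<^sub>i) \<le> 16/15 \<omega>(u, x\<^sub>0)\<close>; in the second case convexity
  of \<open>s \<mapsto> s powr (- (p - 1) / 2)\<close> bounds the sum of the weights from below. If a half step stays in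
  place, the current point already solves the variational inequality up to \<open>\<delta>\<close>.\<close>

section \<open>Norms\<close>

lemma is_norm_zero: "is_norm N \<Longrightarrow> N 0 = 0"
  by (simp add: is_norm_def)

lemma is_norm_scaleR: "is_norm N \<Longrightarrow> N (c *\<^sub>R x) = \<bar>c\<bar> * N x"
  by (simp add: is_norm_def)

lemma is_norm_minus: "is_norm N \<Longrightarrow> N (- x) = N x"
  using is_norm_scaleR[of N "-1" x] by simp

lemma is_norm_minus_commute: "is_norm N \<Longrightarrow> N (x - y) = N (y - x)"
  using is_norm_minus[of N "x - y"] by simp

lemma is_norm_triangle: "is_norm N \<Longrightarrow> N (x + y) \<le> N x + N y"
  by (simp add: is_norm_def)

lemma is_norm_nonneg:
  assumes "is_norm N"
  shows "0 \<le> N x"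
  using is_norm_triangle[OF assms, of x "- x"] is_norm_minus[OF assms, of x] is_norm_zero[OF assms]
  by simp

lemma is_norm_pos: "is_norm N \<Longrightarrow> x \<noteq> 0 \<Longrightarrow> 0 < N x"
  using is_norm_nonneg[of N x] by (auto simp: is_norm_def order_less_le)

lemma is_norm_sum:
  assumes "is_norm N"
  shows "N (\<Sum>i\<in>A. f i) \<le> (\<Sum>i\<in>A. N (f i))"
proof (induction A rule: infinite_finite_induct)
  case (insert x A)
  then show ?case using is_norm_triangle[OF assms, of "f x" "sum f A"] by simp
qed (simp_all add: is_norm_zero[OF assms])

text \<open>Expanding \<open>x\<close> in the Euclidean basis gives one half of the equivalence of
  norms; it makes \<open>N\<close> continuous for the Euclidean topology.\<close>

lemma is_norm_upper_bound:
  fixes N :: "'a::euclidean_space \<Rightarrow> real"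
  assumes N: "is_norm N"
  shows "N x \<le> (\<Sum>b\<in>Basis. N b) * norm x"
proof -
  have "N x = N (\<Sum>b\<in>Basis. (x \<bullet> b) *\<^sub>R b)"
    by (simp add: euclidean_representation)
  also have "\<dots> \<le> (\<Sum>b\<in>Basis. \<bar>x \<bullet> b\<bar> * N b)"
    using is_norm_sum[OF N, of "\<lambda>b. (x \<bullet> b) *\<^sub>R b" Basis] by (simp add: is_norm_scaleR[OF N])
  also have "\<dots> \<le> (\<Sum>b\<in>Basis. norm x * N b)"
    by (intro sum_mono mult_right_mono Basis_le_norm is_norm_nonneg[OF N])
  finally show ?thesis by (simp add: sum_distrib_left mult.commute)
qed

lemma continuous_on_is_norm:
  fixes N :: "'a::euclidean_space \<Rightarrow> real"
  assumes N: "is_norm N"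
  shows "continuous_on S N"
proof -
  define C where "C = (\<Sum>b\<in>Basis. N b)"
  have "C \<ge> 0" unfolding C_def by (intro sum_nonneg is_norm_nonneg[OF N])
  have "C-lipschitz_on S N"
  proof (rule lipschitz_onI)
    fix x y
    have "N x \<le> N y + N (x - y)" "N y \<le> N x + N (x - y)"
      using is_norm_triangle[OF N, of y "x - y"] is_norm_triangle[OF N, of x "y - x"]
        is_norm_minus_commute[OF N, of x y] by auto
    then have "\<bar>N x - N y\<bar> \<le> N (x - y)" by linarith
    then show "dist (N x) (N y) \<le> C * dist x y"
      using is_norm_upper_bound[OF N, of "x - y"] by (simp add: dist_norm C_def)
  qed (fact \<open>C \<ge> 0\<close>)
  then show ?thesis by (rule lipschitz_on_continuous_on)
qed

text \<open>By continuity \<open>N\<close> attains its minimum on the compact Euclidean unit sphere.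
  The minimum is positive, and homogeneity extends the bound to all vectors.\<close>

lemma is_norm_lower_bound:
  fixes N :: "'a::euclidean_space \<Rightarrow> real"
  assumes N: "is_norm N"
  obtains \<kappa> where "\<kappa> > 0" "\<And>x. \<kappa> * norm x \<le> N x"
proof -
  have "sphere (0::'a) 1 \<noteq> {}"
    using norm_Basis SOME_Basis by (metis dist_0_norm empty_iff mem_sphere)
  then obtain u :: 'a where u: "u \<in> sphere 0 1" "\<And>x. x \<in> sphere 0 1 \<Longrightarrow> N u \<le> N x"
    using continuous_attains_inf[OF compact_sphere _ continuous_on_is_norm[OF N]] by metis
  have "N u > 0" using u(1) by (intro is_norm_pos[OF N]) auto
  moreover have "N u * norm x \<le> N x" for x
  proof (cases "x = 0")
    case False
    then have "N u \<le> N ((1 / norm x) *\<^sub>R x)" by (intro u) simp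
    with False show ?thesis by (simp add: is_norm_scaleR[OF N] field_simps)
  qed (simp add: is_norm_zero[OF N])
  ultimately show ?thesis by (rule that)
qed

lemma inner_le_dual_norm:
  fixes N :: "'a::euclidean_space \<Rightarrow> real"
  assumes N: "is_norm N"
  shows "v \<bullet> h \<le> dual_norm N v * N h"
proof (cases "h = 0")
  case False
  obtain \<kappa> where \<kappa>: "\<kappa> > 0" "\<And>x. \<kappa> * norm x \<le> N x" using is_norm_lower_bound[OF N] by blast
  \<comment> \<open>The real \<open>SUP\<close> in \<open>dual_norm\<close> is informative only for
    sets bounded above; equivalence of norms bounds the unit ball of \<open>N\<close>.\<close>
  have bdd: "bdd_above ((\<lambda>h. v \<bullet> h) ` {h. N h \<le> 1})"
  proof (rule bdd_aboveI2)
    fix h assume "h \<in> {h. N h \<le> 1}"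
    with \<kappa>(2)[of h] \<kappa>(1) have "norm h \<le> 1 / \<kappa>" by (simp add: field_simps)
    then have "norm v * norm h \<le> norm v * (1 / \<kappa>)" by (rule mult_left_mono) simp
    then show "v \<bullet> h \<le> norm v * (1 / \<kappa>)" using norm_cauchy_schwarz[of v h] by linarith
  qed
  have pos: "N h > 0" by (rule is_norm_pos[OF N False])
  have "v \<bullet> ((1 / N h) *\<^sub>R h) \<le> dual_norm N v"
    unfolding dual_norm_def by (rule cSUP_upper[OF _ bdd]) (use pos in \<open>simp add: is_norm_scaleR[OF N]\<close>)
  with pos show ?thesis by (simp add: field_simps)
qed (simp add: is_norm_zero[OF N])

section \<open>Taylor expansion\<close>

lemma line_params_shift: "line_params X (x + t *\<^sub>R h) h = {s. t + s \<in> line_params X x h}"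
  by (auto simp: line_params_def algebra_simps)

lemma line_params_scale: "line_params X x (c *\<^sub>R h) = {s. c * s \<in> line_params X x h}"
  by (auto simp: line_params_def mult.commute)

lemma convex_line_params: "convex X \<Longrightarrow> convex (line_params X x h)"
proof (rule convexI)
  fix s t u v :: real
  assume "convex X" "s \<in> line_params X x h" "t \<in> line_params X x h" "0 \<le> u" "0 \<le> v" "u + v = 1"
  then have "u *\<^sub>R (x + s *\<^sub>R h) + v *\<^sub>R (x + t *\<^sub>R h) \<in> X"
    by (intro convexD) (auto simp: line_params_def)
  moreover have "u *\<^sub>R (x + s *\<^sub>R h) + v *\<^sub>R (x + t *\<^sub>R h) = (u + v) *\<^sub>R x + (u * s + v * t) *\<^sub>R h"
    by (simp add: algebra_simps)
  ultimately show "u *\<^sub>R s + v *\<^sub>R t \<in> line_params X x h"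
    using \<open>u + v = 1\<close> by (simp add: line_params_def)
qed

text \<open>A connected set with more than one point has no isolated points. This makes derivatives
  at parameter 0 unique.\<close>

lemma line_params_nontrivial:
  assumes "convex X" "x \<in> X" "line_params X x h \<noteq> {0}"
  shows "at 0 within line_params X x h \<noteq> bot"
proof -
  have "0 \<in> line_params X x h" using assms(2) by (simp add: line_params_def)
  moreover from this have "\<And>s. line_params X x h \<noteq> {s}" using assms(3) by (metis singletonD)
  ultimately show ?thesis
    using connected_imp_perfect[OF convex_connected[OF convex_line_params[OF assms(1)]]]
    by (simp add: trivial_limit_within)
qed

lemma line_params_shift_nontrivial:
  assumes "x \<in> X" "t \<in> line_params X x h" "line_params X x h \<noteq> {0}"
  shows "line_params X (x + t *\<^sub>R h) h \<noteq> {0}"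
proof -
  have "0 \<in> line_params X x h" using assms(1) by (simp add: line_params_def)
  with assms(3) obtain s where "s \<in> line_params X x h" "s \<noteq> 0" by blast
  then have "-t \<in> line_params X (x + t *\<^sub>R h) h" "s - t \<in> line_params X (x + t *\<^sub>R h) h"
    using \<open>0 \<in> line_params X x h\<close> by (simp_all add: line_params_shift)
  with \<open>s \<noteq> 0\<close> show ?thesis by force
qed

text \<open>\<open>dir_deriv\<close> restarts the line at each point and differentiates at parameter
  0. Translating the parameter turns this into differentiation of one fixed curve at
  \<open>t\<close>.\<close>

lemma dir_deriv_has_vector_derivative:
  assumes "dir_differentiable_upto X F m" "i < m" "x \<in> X" "t \<in> line_params X x h"
  shows "((\<lambda>s. dir_deriv X F i (x + s *\<^sub>R h) h) has_vector_derivative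
            dir_deriv X F (Suc i) (x + t *\<^sub>R h) h) (at t within line_params X x h)"
proof -
  let ?x = "x + t *\<^sub>R h"
  have "?x \<in> X" using assms(4) by (simp add: line_params_def)
  then have "((\<lambda>s. dir_deriv X F i (?x + s *\<^sub>R h) h) has_vector_derivative
            dir_deriv X F (Suc i) ?x h) (at 0 within line_params X ?x h)"
    using assms(1,2) by (simp add: dir_differentiable_upto_def vector_derivative_works)
  moreover have "(\<lambda>s. s - t) ` line_params X x h = line_params X ?x h"
    by (force simp: line_params_shift image_iff)
  moreover have "((\<lambda>s. s - t) has_vector_derivative 1) (at t within line_params X x h)"
    by (auto intro!: derivative_eq_intros)
  ultimately have "(((\<lambda>s. dir_deriv X F i (?x + s *\<^sub>R h) h) \<circ> (\<lambda>s. s - t)) has_vector_derivative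
            1 *\<^sub>R dir_deriv X F (Suc i) ?x h) (at t within line_params X x h)"
    by (intro vector_diff_chain_within) auto
  then show ?thesis by (simp add: o_def algebra_simps)
qed

text \<open>Homogeneity in the direction comes from the chain rule for
  \<open>s \<mapsto> c * s\<close>. The induction ranges over all \<open>x\<close> because
  differentiating uses the hypothesis along the whole line. On a line meeting \<open>X\<close> in
  one point \<open>vector_derivative\<close> would be an arbitrary value.\<close>

lemma dir_deriv_scaleR:
  assumes F: "dir_differentiable_upto X F m" and X: "convex X" and c: "c \<noteq> 0"
  shows "i \<le> m \<Longrightarrow> x \<in> X \<Longrightarrow> line_params X x h \<noteq> {0} \<Longrightarrow>
           dir_deriv X F i x (c *\<^sub>R h) = c ^ i *\<^sub>R dir_deriv X F i x h"
proof (induction i arbitrary: x)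
  case (Suc i)
  let ?P = "line_params X x h" and ?Q = "line_params X x (c *\<^sub>R h)"
  have 0: "0 \<in> ?P" using Suc.prems by (simp add: line_params_def)
  have img: "(\<lambda>s. c * s) ` ?Q = ?P"
  proof
    show "?P \<subseteq> (\<lambda>s. c * s) ` ?Q"
    proof
      fix s assume "s \<in> ?P"
      with c show "s \<in> (\<lambda>s. c * s) ` ?Q"
        by (intro image_eqI[of _ _ "s / c"]) (auto simp: line_params_scale)
    qed
  qed (auto simp: line_params_scale)
  have Q: "?Q \<noteq> {0}"
  proof
    assume "?Q = {0}"
    then have "?P = {0}" using img by simp
    with Suc.prems show False by simp
  qed
  have der: "((\<lambda>s. dir_deriv X F i (x + s *\<^sub>R h) h) has_vector_derivative
            dir_deriv X F (Suc i) x h) (at 0 within ?P)"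
    using dir_deriv_has_vector_derivative[OF F _ \<open>x \<in> X\<close> 0] Suc.prems by simp
  have cmul: "((\<lambda>s. c * s) has_vector_derivative c) (at 0 within ?Q)"
    by (auto intro!: derivative_eq_intros simp: has_real_derivative_iff_has_vector_derivative[symmetric])
  have "((\<lambda>s. dir_deriv X F i (x + (c * s) *\<^sub>R h) h) has_vector_derivative
            c *\<^sub>R dir_deriv X F (Suc i) x h) (at 0 within ?Q)"
    using vector_diff_chain_within[OF cmul, of "\<lambda>s. dir_deriv X F i (x + s *\<^sub>R h) h"] der
    by (simp add: img o_def)
  then have "((\<lambda>s. c ^ i *\<^sub>R dir_deriv X F i (x + (c * s) *\<^sub>R h) h) has_vector_derivative
            c ^ i *\<^sub>R c *\<^sub>R dir_deriv X F (Suc i) x h) (at 0 within ?Q)"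
    by (rule bounded_linear.has_vector_derivative[OF bounded_linear_scaleR_right])
  then have "((\<lambda>s. dir_deriv X F i (x + s *\<^sub>R c *\<^sub>R h) (c *\<^sub>R h)) has_vector_derivative
            c ^ i *\<^sub>R c *\<^sub>R dir_deriv X F (Suc i) x h) (at 0 within ?Q)"
  proof (rule has_vector_derivative_transform[rotated 2])
    show "0 \<in> ?Q" using 0 by (simp add: line_params_def)
    fix s assume "s \<in> ?Q"
    then have "c * s \<in> ?P" by (simp add: line_params_scale)
    then have "dir_deriv X F i (x + (c * s) *\<^sub>R h) (c *\<^sub>R h) =
                c ^ i *\<^sub>R dir_deriv X F i (x + (c * s) *\<^sub>R h) h"
      using Suc.prems line_params_shift_nontrivial[of x X "c * s" h]
      by (intro Suc.IH) (auto simp: line_params_def)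
    then show "dir_deriv X F i (x + s *\<^sub>R c *\<^sub>R h) (c *\<^sub>R h) =
                c ^ i *\<^sub>R dir_deriv X F i (x + (c * s) *\<^sub>R h) h"
      by (simp add: mult.commute)
  qed
  then have "dir_deriv X F (Suc i) x (c *\<^sub>R h) = c ^ i *\<^sub>R c *\<^sub>R dir_deriv X F (Suc i) x h"
    using vector_derivative_within[OF line_params_nontrivial[OF X \<open>x \<in> X\<close> Q]] by simp
  then show ?case by (simp add: mult.commute)
qed simp

section \<open>Taylor remainder estimates\<close>

text \<open>A one-sided linear growth bound on \<open>\<phi> m\<close> stands in for a derivative of
  order \<open>m + 1\<close>, so that Lipschitz continuity of the top derivative suffices.\<close>

lemma taylor_remainder_le:
  fixes \<phi> :: "nat \<Rightarrow> real \<Rightarrow> real"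
  assumes "\<And>i t. i < m \<Longrightarrow> t \<in> {0..1} \<Longrightarrow> (\<phi> i has_real_derivative \<phi> (Suc i) t) (at t within {0..1})"
    and "\<And>t. t \<in> {0..1} \<Longrightarrow> \<phi> m t - \<phi> m 0 \<le> M * t"
    and "t \<in> {0..1}"
  shows "\<phi> 0 t - (\<Sum>i\<le>m. \<phi> i 0 * t ^ i / fact i) \<le> M * t ^ Suc m / fact (Suc m)"
  using assms
proof (induction m arbitrary: \<phi> t)
  case 0
  then show ?case by auto
next
  case (Suc m)
  \<comment> \<open>\<open>G\<close> is the defect of the claim. Its derivative \<open>G'\<close> is
    the defect for the shifted family \<open>\<phi> (Suc i)\<close>, nonpositive by the induction
    hypothesis, so \<open>G\<close> decreases from \<open>G 0 = 0\<close>.\<close>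
  define G where "G = (\<lambda>t. \<phi> 0 t - (\<Sum>i\<le>Suc m. \<phi> i 0 * t ^ i / fact i)
                        - M * t ^ Suc (Suc m) / fact (Suc (Suc m)))"
  define G' where "G' = (\<lambda>t. \<phi> 1 t - (\<Sum>i\<le>m. \<phi> (Suc i) 0 * t ^ i / fact i) - M * t ^ Suc m / fact (Suc m))"
  have mono: "((\<lambda>t. c * t ^ Suc k / fact (Suc k)) has_real_derivative c * t ^ k / fact k)
      (at t within {0..1})" for c k and t :: real
    by (rule derivative_eq_intros refl | simp add: field_simps del: of_nat_Suc)+
  have der: "(G has_real_derivative G' t) (at t within {0..1})" if "t \<in> {0..1}" for t
    unfolding G_def G'_def sum.atMost_Suc_shift[of _ m]
    by (rule derivative_eq_intros Suc.prems(1) mono refl that | simp)+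
  have neg: "G' t \<le> 0" if "t \<in> {0..1}" for t
    using Suc.IH[of "\<lambda>i. \<phi> (Suc i)" t] Suc.prems(1,2) that by (simp add: G'_def)
  have "G t \<le> G 0"
  proof (rule DERIV_nonpos_imp_decreasing_open[where f = G])
    show "0 \<le> t" using Suc.prems by simp
    have "continuous_on {0..1} G" using der by (rule DERIV_continuous_on)
    then show "continuous_on {0..t} G"
      by (rule continuous_on_subset) (use Suc.prems(3) in auto)
    fix s assume "0 < s" "s < t"
    then have s: "s \<in> {0..1}" "0 < s" "s < 1" using Suc.prems(3) by auto
    show "\<exists>y. DERIV G s :> y \<and> y \<le> 0"
      using der[OF s(1)] neg[OF s(1)] at_within_Icc_at[OF s(2,3)] by auto
  qed
  moreover have "G 0 = 0" by (simp add: G_def sum.atMost_Suc_shift del: sum.atMost_Suc)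
  ultimately show ?case by (simp add: G_def)
qed

text \<open>The Lipschitz hypothesis covers only directions in the unit ball of \<open>N\<close>.
  Normalizing \<open>h\<close> contributes \<open>N h ^ m\<close> by homogeneity; the remaining
  factor \<open>N h * t\<close> is the distance between the two base points.\<close>

lemma dir_deriv_lipschitz:
  assumes N: "is_norm N" and X: "convex X"
    and F: "dir_differentiable_upto X F m"
    and lip: "\<And>x y h. x \<in> X \<Longrightarrow> y \<in> X \<Longrightarrow> N h \<le> 1 \<Longrightarrow> line_params X x h \<noteq> {0} \<Longrightarrow>
      line_params X y h \<noteq> {0} \<Longrightarrow>
      dual_norm N (dir_deriv X F m y h - dir_deriv X F m x h) \<le> L * N (y - x)"
    and "x \<in> X" "t \<in> line_params X x h" "t \<ge> 0" "line_params X x h \<noteq> {0}" "h \<noteq> 0"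
  shows "(dir_deriv X F m (x + t *\<^sub>R h) h - dir_deriv X F m x h) \<bullet> v \<le> L * N h ^ Suc m * N v * t"
proof -
  let ?y = "x + t *\<^sub>R h"
  define c where "c = N h"
  define e where "e = (1 / c) *\<^sub>R h"
  have c: "c > 0" unfolding c_def using is_norm_pos[OF N \<open>h \<noteq> 0\<close>] .
  have h: "h = c *\<^sub>R e" using c by (simp add: e_def)
  have y: "?y \<in> X" using assms(6) by (simp add: line_params_def)
  have tx: "line_params X z e \<noteq> {0}" if "line_params X z h \<noteq> {0}" "z \<in> X" for z
  proof -
    have "0 \<in> line_params X z h" using that by (simp add: line_params_def)
    with that obtain s where "s \<in> line_params X z h" "s \<noteq> 0" by blast
    then have "c * s \<in> line_params X z e" "c * s \<noteq> 0" using c by (auto simp: h line_params_scale)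
    then show ?thesis by blast
  qed
  note nx = tx[OF \<open>line_params X x h \<noteq> {0}\<close> \<open>x \<in> X\<close>]
  note ny = tx[OF line_params_shift_nontrivial[OF \<open>x \<in> X\<close> assms(6) assms(8)] y]
  let ?D = "dir_deriv X F m ?y e - dir_deriv X F m x e"
  have "N e \<le> 1" using c by (simp add: e_def is_norm_scaleR[OF N]) (simp add: c_def)
  then have "dual_norm N ?D \<le> L * N (?y - x)" using lip[OF \<open>x \<in> X\<close> y _ nx ny] by simp
  also have "\<dots> = L * c * t" using \<open>t \<ge> 0\<close> by (simp add: is_norm_scaleR[OF N] c_def)
  finally have "dual_norm N ?D * N v \<le> L * c * t * N v"
    by (rule mult_right_mono) (rule is_norm_nonneg[OF N])
  with inner_le_dual_norm[OF N, of ?D v] have "?D \<bullet> v \<le> L * c * t * N v" by linarith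
  then have "c ^ m * (?D \<bullet> v) \<le> c ^ m * (L * c * t * N v)"
    using c by (intro mult_left_mono) auto
  moreover have "dir_deriv X F m ?y h - dir_deriv X F m x h = c ^ m *\<^sub>R ?D"
    using dir_deriv_scaleR[OF F X, of c m ?y e] dir_deriv_scaleR[OF F X, of c m x e] c y \<open>x \<in> X\<close> nx ny
    by (simp add: h[symmetric] scaleR_diff_right)
  ultimately have "(dir_deriv X F m ?y h - dir_deriv X F m x h) \<bullet> v \<le> c ^ m * (L * c * t * N v)"
    by simp
  then show ?thesis by (simp add: c_def[symmetric] mult_ac)
qed

text \<open>Both alternatives in the definition of smoothness lead to the same Taylor estimate
  tested against \<open>v\<close>. The remainder form needs only duality; the Lipschitz form goes
  through the scalar Taylor bound on the segment from \<open>x\<close> to \<open>y\<close>.\<close>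

lemma smooth_operator_taylor:
  assumes N: "is_norm N" and X: "convex X" and p: "p \<ge> 1"
    and F: "smooth_operator_on N X p L F" and "x \<in> X" "y \<in> X"
  shows "(F y - taylor_op X F (p - 1) y x) \<bullet> v \<le> L / fact p * N (y - x) ^ p * N v"
  using F unfolding smooth_operator_on_def
proof (elim conjE disjE)
  assume "\<forall>x\<in>X. \<forall>y\<in>X. dual_norm N (F y - taylor_op X F (p - 1) y x) \<le> L / fact p * N (y - x) ^ p"
  then have "dual_norm N (F y - taylor_op X F (p - 1) y x) * N v \<le> L / fact p * N (y - x) ^ p * N v"
    using \<open>x \<in> X\<close> \<open>y \<in> X\<close> is_norm_nonneg[OF N] by (intro mult_right_mono) auto
  with inner_le_dual_norm[OF N] show ?thesis by (rule order_trans)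
next
  define m where "m = p - 1"
  have p_eq: "p = Suc m" using p by (simp add: m_def)
  assume diff: "dir_differentiable_upto X F (p - 1)"
    and lip: "\<forall>x\<in>X. \<forall>y\<in>X. \<forall>h. N h \<le> 1 \<longrightarrow> line_params X x h \<noteq> {0} \<longrightarrow> line_params X y h \<noteq> {0} \<longrightarrow>
         dual_norm N (dir_deriv X F (p - 1) y h - dir_deriv X F (p - 1) x h) \<le> L * N (y - x)"
  define h where "h = y - x"
  define \<phi> where "\<phi> = (\<lambda>i t. dir_deriv X F i (x + t *\<^sub>R h) h \<bullet> v)"
  have sub: "{0..1} \<subseteq> line_params X x h"
  proof
    fix t :: real assume "t \<in> {0..1}"
    then have "(1 - t) *\<^sub>R x + t *\<^sub>R y \<in> X" using X \<open>x \<in> X\<close> \<open>y \<in> X\<close> by (intro convexD) auto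
    then show "t \<in> line_params X x h" by (simp add: line_params_def h_def algebra_simps)
  qed
  have "\<phi> 0 1 - (\<Sum>i\<le>m. \<phi> i 0 * 1 ^ i / fact i) \<le> L * N h ^ p * N v * 1 ^ Suc m / fact (Suc m)"
  proof (rule taylor_remainder_le)
    fix i and t :: real assume "i < m" "t \<in> {0..1}"
    then have "((\<lambda>s. dir_deriv X F i (x + s *\<^sub>R h) h) has_vector_derivative
            dir_deriv X F (Suc i) (x + t *\<^sub>R h) h) (at t within {0..1})"
      using diff sub \<open>x \<in> X\<close>
      by (intro has_vector_derivative_within_subset[OF dir_deriv_has_vector_derivative])
        (auto simp: m_def)
    then show "(\<phi> i has_real_derivative \<phi> (Suc i) t) (at t within {0..1})"
      unfolding has_real_derivative_iff_has_vector_derivative \<phi>_def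
      by (rule bounded_linear.has_vector_derivative[OF bounded_linear_inner_left])
  next
    fix t :: real assume t: "t \<in> {0..1}"
    show "\<phi> m t - \<phi> m 0 \<le> L * N h ^ p * N v * t"
    \<comment> \<open>The zero direction cannot be normalized, but there both sides vanish.\<close>
    proof (cases "h = 0")
      case True
      then show ?thesis by (simp add: \<phi>_def p_eq is_norm_zero[OF N])
    next
      case False
      have "1 \<in> line_params X x h" using sub by auto
      then have "line_params X x h \<noteq> {0}" by (metis singletonD zero_neq_one)
      then have "(dir_deriv X F m (x + t *\<^sub>R h) h - dir_deriv X F m x h) \<bullet> v \<le> L * N h ^ Suc m * N v * t"
        using lip diff t sub False \<open>x \<in> X\<close>
        by (intro dir_deriv_lipschitz[OF N X]) (auto simp: m_def)
      then show ?thesis by (simp add: \<phi>_def p_eq inner_diff_left)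
    qed
  qed simp
  then show ?thesis
    by (simp add: \<phi>_def taylor_op_def m_def[symmetric] p_eq inner_diff_left inner_sum_left h_def)
qed

section \<open>The proximal step\<close>

lemma bregman_ge:
  assumes "strongly_convex_with_gradient N X d gd" "x \<in> X" "y \<in> X"
  shows "(N (x - y))\<^sup>2 \<le> bregman d gd x y"
  using assms by (simp add: strongly_convex_with_gradient_def bregman_def)

lemma bregman_nonneg:
  assumes "strongly_convex_with_gradient N X d gd" "x \<in> X" "y \<in> X"
  shows "0 \<le> bregman d gd x y"
  using bregman_ge[OF assms] by (rule order_trans[rotated]) simp

text \<open>The values of \<open>d\<close> cancel in pairs. The identity trades inner products with
  gradient differences for divergences that telescope or cancel.\<close>

lemma bregman_three_point:
  "(gd y - gd x) \<bullet> (u - y) = bregman d gd u x - bregman d gd u y - bregman d gd y x"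
  by (simp add: bregman_def algebra_simps)

text \<open>First-order optimality on a convex set: a negative slope towards \<open>x\<close> would
  make \<open>f\<close> drop below its minimum on the segment from \<open>z\<close> to
  \<open>x\<close>, which stays in \<open>X\<close>.\<close>

lemma has_derivative_minimum_within_nonneg:
  fixes f :: "'a::real_normed_vector \<Rightarrow> real"
  assumes f: "(f has_derivative f') (at z within X)" and "convex X" "z \<in> X" "x \<in> X"
    and min: "\<And>u. u \<in> X \<Longrightarrow> f z \<le> f u"
  shows "0 \<le> f' (x - z)"
proof (rule ccontr)
  assume "\<not> 0 \<le> f' (x - z)"
  let ?g = "\<lambda>t. z + t *\<^sub>R (x - z)"
  have sub: "?g ` {0..1} \<subseteq> X"
  proof clarify
    fix t :: real assume "t \<in> {0..1}"
    then have "(1 - t) *\<^sub>R z + t *\<^sub>R x \<in> X" using assms by (intro convexD) auto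
    then show "?g t \<in> X" by (simp add: algebra_simps)
  qed
  have "(?g has_derivative (\<lambda>t. t *\<^sub>R (x - z))) (at 0 within {0..1})"
    by (auto intro!: derivative_eq_intros)
  moreover have "(f has_derivative f') (at (?g 0) within ?g ` {0..1})"
    using has_derivative_subset[OF f sub] by simp
  ultimately have "((\<lambda>t. f (?g t)) has_derivative (\<lambda>t. f' (t *\<^sub>R (x - z)))) (at 0 within {0..1})"
    by (rule has_derivative_in_compose)
  moreover have "(\<lambda>t. f' (t *\<^sub>R (x - z))) = (*) (f' (x - z))"
    using linear_scale[OF has_derivative_linear[OF f]] by (auto simp: mult.commute)
  ultimately have "((\<lambda>t. f (?g t)) has_real_derivative f' (x - z)) (at 0 within {0..1})"
    by (simp add: has_field_derivative_def)
  from has_real_derivative_neg_dec_right[OF this] \<open>\<not> 0 \<le> f' (x - z)\<close>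
  obtain e where "e > 0" and e: "\<forall>h>0. 0 + h \<in> {0..1} \<longrightarrow> h < e \<longrightarrow> f (?g (0 + h)) < f (?g 0)"
    by auto
  \<comment> \<open>The parameter \<open>min 1 (e / 2)\<close> is positive, below \<open>e\<close>
    and inside \<open>{0..1}\<close>.\<close>
  from \<open>e > 0\<close> e[rule_format, of "min 1 (e / 2)"] have "f (?g (min 1 (e / 2))) < f z" by simp
  moreover have "min 1 (e / 2) \<in> {0..1}" using \<open>e > 0\<close> by auto
  then have "?g (min 1 (e / 2)) \<in> X" using sub by blast
  ultimately show False using min[of "?g (min 1 (e / 2))"] by simp
qed

text \<open>The divergence grows at least quadratically and the linear term at most linearly, so
  outside a ball around \<open>x\<close> the objective is no smaller than at \<open>x\<close>; on
  the part of \<open>X\<close> in the ball compactness applies.\<close>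

lemma prox_minimizer_exists:
  fixes X :: "'a::euclidean_space set"
  assumes "closed X" and N: "is_norm N" and d: "strongly_convex_with_gradient N X d gd"
    and "x \<in> X" and c: "c > 0"
  shows "\<exists>z\<in>X. \<forall>u\<in>X. g \<bullet> (z - y) + c * bregman d gd z x \<le> g \<bullet> (u - y) + c * bregman d gd u x"
proof -
  define f where "f = (\<lambda>z. g \<bullet> (z - y) + c * bregman d gd z x)"
  obtain \<kappa> where \<kappa>: "\<kappa> > 0" "\<And>x. \<kappa> * norm x \<le> N x" using is_norm_lower_bound[OF N] by blast
  \<comment> \<open>Beyond radius \<open>R\<close> the lower bound
    \<open>c * (\<kappa> * r)\<^sup>2\<close> for the divergence term exceeds
    \<open>norm g * r\<close>.\<close>
  define R where "R = norm g / (c * \<kappa>\<^sup>2)"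
  have "R \<ge> 0" using c by (simp add: R_def)
  have "continuous_on X d"
    using d by (auto simp: strongly_convex_with_gradient_def intro: has_derivative_continuous_on)
  then have "continuous_on (X \<inter> cball x R) f"
    unfolding f_def bregman_def
    by (intro continuous_intros) (auto elim: continuous_on_subset)
  moreover have "compact (X \<inter> cball x R)"
    using \<open>closed X\<close> by (intro closed_Int_compact) auto
  moreover have "x \<in> X \<inter> cball x R" using \<open>x \<in> X\<close> \<open>R \<ge> 0\<close> by simp
  ultimately obtain z where z: "z \<in> X" "\<And>u. u \<in> X \<inter> cball x R \<Longrightarrow> f z \<le> f u"
    using continuous_attains_inf[of "X \<inter> cball x R" f] by blast
  have "f z \<le> f u" if "u \<in> X" for u
  proof (cases "u \<in> cball x R")
    case False
    then have "R \<le> norm (u - x)" by (simp add: dist_norm norm_minus_commute)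
    then have "norm g \<le> c * \<kappa>\<^sup>2 * norm (u - x)"
      using c \<kappa>(1) by (simp add: R_def pos_divide_le_eq mult.commute)
    then have "norm g * norm (u - x) \<le> c * (\<kappa> * norm (u - x))\<^sup>2"
      using mult_right_mono[of "norm g" _ "norm (u - x)"] by (fastforce simp: power2_eq_square mult_ac)
    also have "\<dots> \<le> c * bregman d gd u x"
      using c \<kappa> power_mono[of "\<kappa> * norm (u - x)" "N (u - x)" 2] bregman_ge[OF d that \<open>x \<in> X\<close>]
      by (intro mult_left_mono) auto
    finally have "0 \<le> g \<bullet> (u - x) + c * bregman d gd u x"
      using Cauchy_Schwarz_ineq2[of g "u - x"] by linarith
    then have "f x \<le> f u" by (simp add: f_def bregman_def inner_diff_right)
    moreover have "f z \<le> f x" using z(2) \<open>x \<in> X\<close> \<open>R \<ge> 0\<close> by simp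
    ultimately show ?thesis by simp
  qed (use z that in auto)
  with z(1) show ?thesis by (auto simp: f_def)
qed

text \<open>Existence of a minimizer comes first, since \<open>arg_min_on\<close> is a choice.
  First-order optimality at \<open>z\<close> then becomes a bound in divergences by the three-point
  identity.\<close>

lemma prox_step:
  fixes X :: "'a::euclidean_space set" and g y :: 'a
  assumes X: "closed X" "convex X" and N: "is_norm N" and d: "strongly_convex_with_gradient N X d gd"
    and x: "x \<in> X" and c: "c > 0"
  defines "z \<equiv> arg_min_on (\<lambda>z. g \<bullet> (z - y) + c * bregman d gd z x) X"
  shows "z \<in> X"
    and "u \<in> X \<Longrightarrow> g \<bullet> (z - u) \<le> c * (bregman d gd u x - bregman d gd u z - bregman d gd z x)"
proof -
  let ?f = "\<lambda>z. g \<bullet> (z - y) + c * bregman d gd z x"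
  obtain z0 where "is_arg_min ?f (\<lambda>z. z \<in> X) z0"
    using prox_minimizer_exists[OF X(1) N d x c, of g y] by (auto simp: is_arg_min_linorder)
  then have "is_arg_min ?f (\<lambda>z. z \<in> X) z"
    unfolding z_def arg_min_on_def arg_min_def by (rule someI)
  then have z: "z \<in> X" and min: "\<And>u. u \<in> X \<Longrightarrow> ?f z \<le> ?f u" by (auto simp: is_arg_min_linorder)
  show "z \<in> X" by fact
  assume u: "u \<in> X"
  have "(d has_derivative (\<lambda>h. gd z \<bullet> h)) (at z within X)"
    using d z by (simp add: strongly_convex_with_gradient_def)
  then have "(?f has_derivative (\<lambda>h. g \<bullet> h + c * (gd z \<bullet> h - gd x \<bullet> h))) (at z within X)"
    unfolding bregman_def by (auto intro!: derivative_eq_intros)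
  from has_derivative_minimum_within_nonneg[OF this X(2) z u min]
  have "g \<bullet> (z - u) \<le> c * ((gd z - gd x) \<bullet> (u - z))"
    by (simp add: algebra_simps)
  then show "g \<bullet> (z - u) \<le> c * (bregman d gd u x - bregman d gd u z - bregman d gd z x)"
    by (simp only: bregman_three_point[where d = d])
qed

section \<open>One extragradient iteration\<close>

text \<open>Since \<open>1 / 0 = 0\<close>, a vanishing divergence would yield weight 0 when
  \<open>p > 1\<close>; for \<open>p = 1\<close> the power is empty and the weight is
  \<open>1 / 2\<close>.\<close>

lemma step_weight_pos:
  assumes "0 \<le> bregman d gd y x" "p = 1 \<or> bregman d gd y x \<noteq> 0"
  shows "0 < step_weight d gd p y x"
  using assms by (auto simp: step_weight_def)

text \<open>The constant 15/16 comes from \<open>a b / 2 \<le> a\<^sup>2 / 16 + b\<^sup>2\<close>, applied to the Taylor error with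
  \<open>a\<^sup>2\<close> the divergence of the half step and \<open>b = N (y - z)\<close>.\<close>

lemma extragradient_step:
  fixes X :: "'a::euclidean_space set"
  assumes X: "closed X" "convex X" and N: "is_norm N" and d: "strongly_convex_with_gradient N X d gd"
    and F: "smooth_operator_on N X p L F" and p: "p \<ge> 1" and L: "L > 0"
    and x: "x \<in> X" and sol: "approx_vi_solution X F d gd p L \<delta> x y" and u: "u \<in> X"
    and nz: "p = 1 \<or> bregman d gd y x \<noteq> 0"
  defines "w \<equiv> step_weight d gd p y x"
  defines "z \<equiv> arg_min_on (\<lambda>z. F y \<bullet> (z - y) + L / (fact p * w) * bregman d gd z x) X"
  shows "z \<in> X"
    and "w * (F y \<bullet> (y - u)) \<le> w * \<delta>
           + L / fact p * (bregman d gd u x - bregman d gd u z - 15 / 16 * bregman d gd y x)"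
proof -
  let ?B = "bregman d gd" and ?T = "taylor_op X F (p - 1) y x"
  have y: "y \<in> X" using sol by (simp add: approx_vi_solution_def)
  define a where "a = sqrt (?B y x)"
  have a2: "a\<^sup>2 = ?B y x" using bregman_nonneg[OF d y x] by (simp add: a_def)
  have "a \<ge> 0" using bregman_nonneg[OF d y x] by (simp add: a_def)
  have w: "w > 0" unfolding w_def using bregman_nonneg[OF d y x] nz by (rule step_weight_pos)
  have "a ^ (p - 1) \<noteq> 0" using nz a2 by auto
  then have wa: "2 * w * a ^ (p - 1) = 1" by (simp add: w_def step_weight_def a_def)
  define c where "c = L / (fact p * w)"
  have c: "c > 0" using L w by (simp add: c_def)
  have cw: "w * c = L / fact p" using w by (simp add: c_def)
  note prox = prox_step[OF X N d x c, where g = "F y" and y = y, folded z_def[folded c_def]]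
  show z: "z \<in> X" by (rule prox)
  have 1: "F y \<bullet> (z - u) \<le> c * (?B u x - ?B u z - ?B z x)" by (rule prox(2)[OF u])
  \<comment> \<open>The weight is chosen so that the regularizer of the subproblem and the proximal
    step carry the same coefficient.\<close>
  have "2 * L / fact p * a ^ (p - 1) = c"
    using w wa by (simp add: c_def field_simps)
  \<comment> \<open>The approximate variational inequality is tested at the proximal point
    \<open>z\<close>; the passage from \<open>z\<close> to \<open>u\<close> is left to the proximal
    step.\<close>
  then have "(?T + c *\<^sub>R (gd y - gd x)) \<bullet> (y - z) \<le> \<delta>"
    using sol z by (simp add: approx_vi_solution_def regularized_operator_def a_def)
  then have "?T \<bullet> (y - z) \<le> \<delta> + c * ((gd y - gd x) \<bullet> (z - y))"
    by (simp add: algebra_simps)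
  then have 2: "?T \<bullet> (y - z) \<le> \<delta> + c * (?B z x - ?B z y - ?B y x)"
    by (simp only: bregman_three_point[where d = d])
  let ?n = "N (y - z)"
  have "N (y - x) \<le> a"
    unfolding a_def by (rule real_le_rsqrt) (rule bregman_ge[OF d y x])
  then have "N (y - x) ^ p \<le> a ^ p" by (rule power_mono) (rule is_norm_nonneg[OF N])
  then have "L / fact p * N (y - x) ^ p * ?n \<le> L / fact p * a ^ p * ?n"
    using L is_norm_nonneg[OF N] by (intro mult_right_mono mult_left_mono) auto
  with smooth_operator_taylor[OF N X(2) p F x y, of "y - z"]
  have "(F y - ?T) \<bullet> (y - z) \<le> L / fact p * a ^ p * ?n" by linarith
  also have "\<dots> = c * (w * a ^ p * ?n)" by (simp add: cw[symmetric])
  also have "w * a ^ p = a / 2" using wa p by (cases p) (simp_all add: mult_ac)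
  also have "a / 2 * ?n \<le> a\<^sup>2 / 16 + ?n\<^sup>2"
    using zero_le_power2[of "a / 4 - ?n"] by (simp add: power2_eq_square algebra_simps)
  also have "?n\<^sup>2 \<le> ?B z y" using bregman_ge[OF d z y] by (simp add: is_norm_minus_commute[OF N])
  finally have 3: "(F y - ?T) \<bullet> (y - z) \<le> c * (?B y x / 16 + ?B z y)"
    using c by (simp add: a2)
  \<comment> \<open>Taylor error, model and proximal step are added; the divergences of
    \<open>z\<close> from \<open>x\<close> and from \<open>y\<close> cancel.\<close>
  have "F y \<bullet> (y - u) = (F y - ?T) \<bullet> (y - z) + ?T \<bullet> (y - z) + F y \<bullet> (z - u)"
    by (simp add: algebra_simps)
  also have "\<dots> \<le> c * (?B y x / 16 + ?B z y) + (\<delta> + c * (?B z x - ?B z y - ?B y x))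
                    + c * (?B u x - ?B u z - ?B z x)"
    using 1 2 3 by linarith
  also have "\<dots> = \<delta> + c * (?B u x - ?B u z - 15 / 16 * ?B y x)" by (simp add: algebra_simps)
  finally have "w * (F y \<bullet> (y - u)) \<le> w * (\<delta> + c * (?B u x - ?B u z - 15 / 16 * ?B y x))"
    using w by (intro mult_left_mono) auto
  also have "\<dots> = w * \<delta> + w * c * (?B u x - ?B u z - 15 / 16 * ?B y x)" by (simp add: algebra_simps)
  finally show "w * (F y \<bullet> (y - u)) \<le> w * \<delta>
           + L / fact p * (?B u x - ?B u z - 15 / 16 * ?B y x)"
    by (simp only: cw)
qed

section \<open>Convergence\<close>

text \<open>The right side is the tangent at \<open>m\<^sup>2\<close> of the convex function
  \<open>s \<mapsto> s powr (- q / 2)\<close>, evaluated at \<open>a\<^sup>2\<close>. With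
  \<open>s = m / a\<close> it follows from Bernoulli's inequality and
  \<open>s - 1 \<ge> (1 - 1 / s\<^sup>2) / 2\<close>.\<close>

lemma inverse_power_tangent:
  fixes a m :: real
  assumes "m > 0" "a \<ge> 0" "q = 0 \<or> a \<noteq> 0"
  shows "1 / a ^ q \<ge> 1 / m ^ q * (1 + real q / 2 * (1 - a\<^sup>2 / m\<^sup>2))"
proof (cases "q = 0")
  case False
  with assms have a: "a > 0" by simp
  define s where "s = m / a"
  have s: "s > 0" using a \<open>m > 0\<close> by (simp add: s_def)
  have "0 \<le> (s - 1)\<^sup>2 * (2 * s + 1) / (2 * s\<^sup>2)" using s by simp
  also have "\<dots> = s - 1 - (1 - 1 / s\<^sup>2) / 2"
    using s by (simp add: field_simps) (simp add: power2_eq_square algebra_simps)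
  finally have "real q * ((1 - 1 / s\<^sup>2) / 2) \<le> real q * (s - 1)" by (intro mult_left_mono) auto
  also have "\<dots> + 1 \<le> s ^ q" using Bernoulli_inequality[of "s - 1" q] s by simp
  finally have "1 + real q / 2 * (1 - 1 / s\<^sup>2) \<le> s ^ q" by simp
  then have "1 / m ^ q * (1 + real q / 2 * (1 - 1 / s\<^sup>2)) \<le> 1 / m ^ q * s ^ q"
    using \<open>m > 0\<close> by (intro mult_left_mono) auto
  also have "1 / m ^ q * s ^ q = 1 / a ^ q" using \<open>m > 0\<close> by (simp add: s_def power_divide)
  also have "1 / s\<^sup>2 = a\<^sup>2 / m\<^sup>2" by (simp add: s_def power_divide)
  finally show ?thesis by simp
qed simp

text \<open>A form of Jensen's inequality: add the tangents at the common point
  \<open>m\<^sup>2\<close>. Their linear parts have a nonnegative sum because the mean of the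
  squares is at most \<open>m\<^sup>2\<close>.\<close>

lemma sum_inverse_power_ge:
  fixes a :: "'i \<Rightarrow> real"
  assumes m: "m > 0" and "\<And>i. i \<in> I \<Longrightarrow> a i \<ge> 0" "\<And>i. i \<in> I \<Longrightarrow> q = 0 \<or> a i \<noteq> 0"
    and sum: "(\<Sum>i\<in>I. (a i)\<^sup>2) \<le> real (card I) * m\<^sup>2"
  shows "(\<Sum>i\<in>I. 1 / a i ^ q) \<ge> real (card I) / m ^ q"
proof -
  have "(\<Sum>i\<in>I. (a i)\<^sup>2) / m\<^sup>2 \<le> real (card I)" using sum m by (simp add: field_simps)
  then have "real (card I) / m ^ q \<le>
      1 / m ^ q * (real (card I) + real q / 2 * (real (card I) - (\<Sum>i\<in>I. (a i)\<^sup>2) / m\<^sup>2))"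
    using m by (simp add: field_simps mult_left_mono)
  also have "\<dots> = (\<Sum>i\<in>I. 1 / m ^ q * (1 + real q / 2 * (1 - (a i)\<^sup>2 / m\<^sup>2)))"
    by (simp only: sum_distrib_left[symmetric] sum.distrib sum_subtractf sum_divide_distrib[symmetric])
      simp
  also have "\<dots> \<le> (\<Sum>i\<in>I. 1 / a i ^ q)"
    using assms by (intro sum_mono inverse_power_tangent) auto
  finally show ?thesis .
qed

text \<open>Here \<open>A\<close> stands for \<open>L / p!\<close>, \<open>D\<close> for the initial
  divergence and \<open>a i\<close> for the square root of the divergence of a half step. Either the
  left side is nonpositive, or the squares sum to less than \<open>16 / 15 * D\<close> and the
  weights are large.\<close>

lemma average_error_bound:
  fixes a :: "nat \<Rightarrow> real"
  assumes p: "p \<ge> 1" and A: "A > 0" and \<epsilon>: "\<epsilon> > 0"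
    and a: "\<And>i. i \<le> K \<Longrightarrow> a i \<ge> 0" "\<And>i. i \<le> K \<Longrightarrow> p = 1 \<or> a i \<noteq> 0"
    and K: "16 / 15 * (4 * A) powr (2 / (real p + 1)) * D / \<epsilon> powr (2 / (real p + 1)) \<le> real (K + 1)"
  shows "A * (D - 15 / 16 * (\<Sum>i\<le>K. (a i)\<^sup>2)) \<le> \<epsilon> / 2 * (\<Sum>i\<le>K. 1 / (2 * a i ^ (p - 1)))"
proof (cases "D \<le> 15 / 16 * (\<Sum>i\<le>K. (a i)\<^sup>2)")
  case True
  then have "A * (D - 15 / 16 * (\<Sum>i\<le>K. (a i)\<^sup>2)) \<le> 0" using A by (simp add: mult_le_0_iff)
  also have "0 \<le> \<epsilon> / 2 * (\<Sum>i\<le>K. 1 / (2 * a i ^ (p - 1)))"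
    using \<epsilon> a(1) by (intro mult_nonneg_nonneg sum_nonneg) auto
  finally show ?thesis .
next
  case False
  let ?S = "\<Sum>i\<le>K. (a i)\<^sup>2" and ?n = "real (K + 1)"
  have "?S \<ge> 0" by (intro sum_nonneg) auto
  with False have D: "D > 0" by linarith
  \<comment> \<open>\<open>m\<^sup>2\<close> is the resulting bound on the mean of the squares over
    \<open>K + 1\<close> steps.\<close>
  define m where "m = sqrt (16 / 15 * D / ?n)"
  have m: "m > 0" using D by (simp add: m_def)
  have m2: "m\<^sup>2 = 16 / 15 * D / ?n" using D by (simp add: m_def)
  then have nm2: "?n * m\<^sup>2 = 16 / 15 * D" by (simp only: m2) (simp add: field_simps)
  define r where "r = 2 / (real p + 1)"
  have r: "r > 0" by (simp add: r_def)
  \<comment> \<open>This is the hypothesis on \<open>K\<close> solved for \<open>m\<^sup>2\<close>;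
    raising it to the power \<open>1 / r = (p + 1) / 2\<close> gives the bound on
    \<open>m ^ (p + 1)\<close>.\<close>
  have "m\<^sup>2 \<le> (\<epsilon> / (4 * A)) powr r"
    using K A \<epsilon> unfolding m2 r_def[symmetric] by (simp add: powr_divide field_simps)
  then have "(m\<^sup>2) powr (1 / r) \<le> ((\<epsilon> / (4 * A)) powr r) powr (1 / r)"
    using r by (intro powr_mono2) auto
  also have "\<dots> = \<epsilon> / (4 * A)" using r \<epsilon> A by (simp add: powr_powr)
  also have "m\<^sup>2 = m powr 2" using m by (simp add: powr_numeral)
  also have "(m powr 2) powr (1 / r) = m powr (2 * (1 / r))" by (simp add: powr_powr)
  also have "2 * (1 / r) = real (p + 1)" by (simp add: r_def field_simps)
  also have "m powr real (p + 1) = m ^ (p + 1)" using m by (rule powr_realpow)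
  finally have mp: "4 * A * m ^ (p + 1) \<le> \<epsilon>" using A by (simp add: field_simps)
  have "(\<Sum>i\<le>K. 1 / a i ^ (p - 1)) \<ge> real (card {..K}) / m ^ (p - 1)"
    using m False nm2 a p by (intro sum_inverse_power_ge) auto
  then have n: "?n \<le> m ^ (p - 1) * (\<Sum>i\<le>K. 1 / a i ^ (p - 1))"
    using m by (simp add: field_simps)
  \<comment> \<open>Dropping \<open>?S\<close> and enlarging \<open>D\<close> to
    \<open>16 / 15 * D\<close> produces exactly \<open>A * m\<^sup>2 * ?n\<close>.\<close>
  have "A * (D - 15 / 16 * ?S) \<le> A * (16 / 15 * D)"
    using A D \<open>?S \<ge> 0\<close> by (intro mult_left_mono) auto
  also have "\<dots> = A * m\<^sup>2 * ?n" unfolding nm2[symmetric] by (simp only: mult_ac)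
  also have "\<dots> \<le> A * m\<^sup>2 * (m ^ (p - 1) * (\<Sum>i\<le>K. 1 / a i ^ (p - 1)))"
    using n A by (intro mult_left_mono) auto
  also have "\<dots> = A * m ^ (p + 1) * (\<Sum>i\<le>K. 1 / a i ^ (p - 1))"
    using p by (cases p) (simp_all add: power2_eq_square)
  also have "\<dots> \<le> \<epsilon> / 4 * (\<Sum>i\<le>K. 1 / a i ^ (p - 1))"
    using mp a(1) by (intro mult_right_mono sum_nonneg) auto
  also have "\<dots> = \<epsilon> / 2 * (\<Sum>i\<le>K. 1 / (2 * a i ^ (p - 1)))"
    by (simp add: sum_distrib_left)
  finally show ?thesis .
qed

section \<open>Feasible iterates and stationary half steps\<close>

lemma mvi_iterate_step:
  fixes X :: "'a::euclidean_space set" and x0 :: 'a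
  assumes X: "closed X" "convex X" and N: "is_norm N" and d: "strongly_convex_with_gradient N X d gd"
    and F: "smooth_operator_on N X p L F" and p: "p \<ge> 1" and L: "L > 0"
    and sol: "\<forall>z\<in>X. approx_vi_solution X F d gd p L \<delta> z (solve z)" and u: "u \<in> X"
  defines "x \<equiv> mvi_iterate X F d gd p L solve x0"
  assumes "x i \<in> X" and nz: "p = 1 \<or> bregman d gd (solve (x i)) (x i) \<noteq> 0"
  shows "x (Suc i) \<in> X"
    and "step_weight d gd p (solve (x i)) (x i) * (F (solve (x i)) \<bullet> (solve (x i) - u))
      \<le> step_weight d gd p (solve (x i)) (x i) * \<delta>
         + L / fact p * (bregman d gd u (x i) - bregman d gd u (x (Suc i))
              - 15 / 16 * bregman d gd (solve (x i)) (x i))"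
  using extragradient_step[OF X N d F p L \<open>x i \<in> X\<close> bspec[OF sol \<open>x i \<in> X\<close>] u nz]
  by (simp_all add: x_def Let_def)

text \<open>If \<open>p > 1\<close> and the divergence vanished, division by zero would make the
  proximal coefficient 0, and a minimizer might not exist. Feasibility is therefore claimed only
  while all earlier divergences are nonzero or \<open>p = 1\<close>.\<close>

lemma mvi_iterate_in:
  fixes X :: "'a::euclidean_space set"
  assumes X: "closed X" "convex X" and N: "is_norm N" and d: "strongly_convex_with_gradient N X d gd"
    and F: "smooth_operator_on N X p L F" and p: "p \<ge> 1" and L: "L > 0"
    and sol: "\<forall>z\<in>X. approx_vi_solution X F d gd p L \<delta> z (solve z)"
    and x0: "x0 \<in> X"
  defines "x \<equiv> mvi_iterate X F d gd p L solve x0"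
  assumes nz: "\<And>j. j < i \<Longrightarrow> p = 1 \<or> bregman d gd (solve (x j)) (x j) \<noteq> 0"
  shows "x i \<in> X"
  using nz
proof (induction i)
  case 0
  then show ?case using x0 by (simp add: x_def)
next
  case (Suc i)
  then show ?case
    using mvi_iterate_step(1)[OF X N d F p L sol x0, where i = i and ?x0.0 = x0] by (simp add: x_def)
qed

text \<open>By strong convexity a zero divergence forces \<open>y = x\<close>. The regularizer then
  vanishes, and the inequality for the Taylor model passes to \<open>F\<close> itself.\<close>

lemma approx_vi_solution_fixed_point:
  fixes X :: "'a::euclidean_space set"
  assumes N: "is_norm N" and X: "convex X" and d: "strongly_convex_with_gradient N X d gd"
    and F: "smooth_operator_on N X p L F" and p: "p \<ge> 1"
    and x: "x \<in> X" and sol: "approx_vi_solution X F d gd p L \<delta> x y"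
    and zero: "bregman d gd y x = 0" and u: "u \<in> X"
  shows "F y \<bullet> (y - u) \<le> \<delta>"
proof -
  have y: "y \<in> X" using sol by (simp add: approx_vi_solution_def)
  have "N (y - x) = 0" using bregman_ge[OF d y x] zero by simp
  then have "y = x" using N by (simp add: is_norm_def)
  \<comment> \<open>The Taylor estimate at radius 0, with \<open>0 ^ p = 0\<close>, replaces an
    evaluation of the derivatives along the zero direction.\<close>
  then have "(F y - taylor_op X F (p - 1) y x) \<bullet> (y - u) \<le> 0"
    using smooth_operator_taylor[OF N X p F x y, of "y - u"] p by (simp add: is_norm_zero[OF N] power_0_left)
  moreover have "taylor_op X F (p - 1) y x \<bullet> (y - u) \<le> \<delta>"
    using sol u \<open>y = x\<close> by (simp add: approx_vi_solution_def regularized_operator_def)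
  ultimately show ?thesis by (simp add: inner_diff_left)
qed

lemma monotone_operator_le:
  assumes "monotone_operator_on X F" "x \<in> X" "y \<in> X"
  shows "F x \<bullet> (y - x) \<le> F y \<bullet> (y - x)"
  using assms by (force simp: monotone_operator_on_def inner_diff_left)

section \<open>Error of the returned point after \<open>K + 1\<close> solver calls\<close>

theorem theoremB2:
  fixes X :: "'a::euclidean_space set"
    and F gd solve :: "'a \<Rightarrow> 'a"
    and N d :: "'a \<Rightarrow> real"
    and p :: nat
    and L \<epsilon> \<delta> :: real
    and x0 :: 'a
  assumes "\<epsilon> > 0" and "p \<ge> 1" and "\<delta> \<le> \<epsilon> / 2" and "L > 0"
    and "closed X" and "convex X"
    and "is_norm N"
    and "monotone_operator_on X F" and "continuous_on X F"
    and "smooth_operator_on N X p L F"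
    and "strongly_convex_with_gradient N X d gd"
    and "x0 \<in> X"
    and "\<forall>z\<in>X. approx_vi_solution X F d gd p L \<delta> z (solve z)"
  shows "\<forall>x\<in>X. \<forall>K.
    16 / 15 * (4 * L / fact p) powr (2 / (real p + 1)) * bregman d gd x x0
        / \<epsilon> powr (2 / (real p + 1)) \<le> real (K + 1) \<longrightarrow>
    F x \<bullet> (mvi_opt_approx X F d gd p L solve x0 K - x) \<le> \<epsilon>"
proof (intro ballI allI impI)
  note hyps = assms(5-7,11,10,2,4,13)
  fix u K
  assume u: "u \<in> X"
    and K: "16 / 15 * (4 * L / fact p) powr (2 / (real p + 1)) * bregman d gd u x0
        / \<epsilon> powr (2 / (real p + 1)) \<le> real (K + 1)"
  define x where "x = mvi_iterate X F d gd p L solve x0"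
  define y where "y = (\<lambda>i. solve (x i))"
  define w where "w = (\<lambda>i. step_weight d gd p (y i) (x i))"
  define B where "B = (\<lambda>i. bregman d gd (y i) (x i))"
  have result: "mvi_opt_approx X F d gd p L solve x0 K =
      (if p > 1 \<and> (\<exists>i\<le>K. B i = 0) then y (LEAST i. B i = 0)
       else (1 / (\<Sum>i\<le>K. w i)) *\<^sub>R (\<Sum>i\<le>K. w i *\<^sub>R y i))"
    by (auto simp: mvi_opt_approx_def Let_def x_def y_def w_def B_def)
  have in_X: "x i \<in> X" if "\<And>j. j < i \<Longrightarrow> p = 1 \<or> B j \<noteq> 0" for i
    using mvi_iterate_in[OF hyps assms(12), of i] that by (simp add: x_def B_def y_def)
  have sol: "approx_vi_solution X F d gd p L \<delta> (x i) (y i)" if "x i \<in> X" for i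
    using assms(13) that by (simp add: y_def)
  have y_in: "y i \<in> X" if "x i \<in> X" for i
    using sol[OF that] by (simp add: approx_vi_solution_def)
  show "F u \<bullet> (mvi_opt_approx X F d gd p L solve x0 K - u) \<le> \<epsilon>"
  proof (cases "p > 1 \<and> (\<exists>i\<le>K. B i = 0)")
    case True
    define i where "i = (LEAST i. B i = 0)"
    have zero: "B i = 0" unfolding i_def by (rule LeastI_ex) (use True in blast)
    \<comment> \<open>Minimality of \<open>i\<close> keeps all earlier divergences nonzero, so
      \<open>x i\<close> is still feasible.\<close>
    have xi: "x i \<in> X" by (rule in_X) (use not_less_Least in \<open>auto simp: i_def\<close>)
    have "F u \<bullet> (y i - u) \<le> F (y i) \<bullet> (y i - u)"
      using monotone_operator_le[OF assms(8) u y_in[OF xi]] .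
    also have "\<dots> \<le> \<delta>"
      using zero approx_vi_solution_fixed_point[OF assms(7,6,11,10,2) xi sol[OF xi] _ u]
      by (simp add: B_def)
    finally show ?thesis using True assms(1,3) by (simp add: result i_def)
  next
    case False
    then have nz: "p = 1 \<or> B i \<noteq> 0" if "i \<le> K" for i using that \<open>p \<ge> 1\<close> by force
    \<comment> \<open>The range includes \<open>Suc K\<close>, the iterate after the last call: its
      divergence is dropped after telescoping and must be nonnegative.\<close>
    have xi: "x i \<in> X" if "i \<le> Suc K" for i using that by (intro in_X nz) auto
    have B: "B i \<ge> 0" if "i \<le> K" for i
      unfolding B_def using that by (intro bregman_nonneg[OF assms(11)] xi y_in) auto
    have w: "w i > 0" if "i \<le> K" for i
      unfolding w_def using B[OF that] nz[OF that] by (intro step_weight_pos) (auto simp: B_def)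
    have W: "(\<Sum>i\<le>K. w i) > 0" using w by (intro sum_pos) auto
    \<comment> \<open>The tolerance is split evenly: one half covers the solver error
      \<open>\<delta>\<close>, the other the telescoped divergences.\<close>
    have absorb: "S * \<delta> + \<epsilon> / 2 * S \<le> S * \<epsilon>" if "S > 0" for S :: real
      using mult_left_mono[OF assms(3) less_imp_le[OF that]] by (simp add: mult.commute)
    define \<beta> where "\<beta> = (\<lambda>i. bregman d gd u (x i))"
    have step: "w i * (F u \<bullet> (y i - u)) \<le> w i * \<delta> + L / fact p * (\<beta> i - \<beta> (Suc i) - 15 / 16 * B i)"
      if "i \<le> K" for i
    proof -
      have i: "x i \<in> X" using that by (intro xi) auto
      have "w i * (F u \<bullet> (y i - u)) \<le> w i * (F (y i) \<bullet> (y i - u))"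
        using w[OF that] monotone_operator_le[OF assms(8) u y_in[OF i]] by (intro mult_left_mono) auto
      also have "\<dots> \<le> w i * \<delta> + L / fact p * (\<beta> i - \<beta> (Suc i) - 15 / 16 * B i)"
        using mvi_iterate_step(2)[OF hyps u, where i = i and ?x0.0 = x0] i nz[OF that]
        unfolding \<beta>_def B_def w_def y_def x_def by blast
      finally show ?thesis .
    qed
    \<comment> \<open>Multiplying by the total weight turns the inner product with the average into
      a weighted sum over the half steps.\<close>
    have "(\<Sum>i\<le>K. w i) * (F u \<bullet> (mvi_opt_approx X F d gd p L solve x0 K - u))
        = F u \<bullet> (\<Sum>i\<le>K. w i *\<^sub>R y i) - (\<Sum>i\<le>K. w i) * (F u \<bullet> u)"
      using W by (simp only: result False if_False) (simp add: inner_diff_right right_diff_distrib)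
    also have "\<dots> = (\<Sum>i\<le>K. w i * (F u \<bullet> (y i - u)))"
      by (simp add: inner_sum_right sum_distrib_right sum_subtractf inner_diff_right right_diff_distrib)
    also have "\<dots> \<le> (\<Sum>i\<le>K. w i * \<delta> + L / fact p * (\<beta> i - \<beta> (Suc i) - 15 / 16 * B i))"
      using step by (intro sum_mono) auto
    also have "\<dots> = (\<Sum>i\<le>K. w i) * \<delta> + L / fact p * (\<beta> 0 - \<beta> (Suc K) - 15 / 16 * (\<Sum>i\<le>K. B i))"
      unfolding sum_telescope[symmetric]
      by (simp only: sum.distrib sum_subtractf sum_distrib_left sum_distrib_right right_diff_distrib)
    also have "\<dots> \<le> (\<Sum>i\<le>K. w i) * \<delta> + L / fact p * (\<beta> 0 - 15 / 16 * (\<Sum>i\<le>K. B i))"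
      using bregman_nonneg[OF assms(11) u xi[of "Suc K"]] \<open>L > 0\<close>
      by (intro add_left_mono mult_left_mono) (auto simp: \<beta>_def)
    \<comment> \<open>With \<open>a i = sqrt (B i)\<close> the weights \<open>w i\<close> are the
      summands \<open>1 / (2 * a i ^ (p - 1))\<close> of the averaging bound.\<close>
    also have "L / fact p * (\<beta> 0 - 15 / 16 * (\<Sum>i\<le>K. B i)) \<le> \<epsilon> / 2 * (\<Sum>i\<le>K. w i)"
      using average_error_bound[OF \<open>p \<ge> 1\<close> _ \<open>\<epsilon> > 0\<close>, of "L / fact p" K "\<lambda>i. sqrt (B i)" "\<beta> 0"]
        K B nz \<open>L > 0\<close>
      by (simp add: \<beta>_def x_def w_def step_weight_def B_def)
    also have "(\<Sum>i\<le>K. w i) * \<delta> + \<epsilon> / 2 * (\<Sum>i\<le>K. w i) \<le> (\<Sum>i\<le>K. w i) * \<epsilon>"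
      using absorb[OF W] .
    finally show ?thesis using W by simp
  qed
qed

end
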